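(* Let $\Phi$ be a weighted undirected graph with finite vertex set ${\tt N}$, let $\aleph$ be a partition of ${\tt N}$ by which $\Phi$ is tree-divisible, let ${\textsc F}'\in{\sf F}^k(\Phi|\aleph)$ and let ${\textsc F}$ be a minimal principal of ${\textsc F}'$. Then ${\textsc F}\in\tilde{\sf F}^{*k}$ if and only if ${\textsc F}'\in\tilde{\sf F}^k(\Phi|\aleph)$.
   Context: $\Phi$ has real edge weights $\phi_{ij}$. Forests are acyclic undirected graphs, trees are connected acyclic graphs. For a subgraph ${\textsc G}$ of $\Phi$, $\Upsilon^{\textsc G}$ is the sum of its edge weights; ${\textsc G}|_{\tt D}$ is the induced subgraph on ${\tt D}$. ${\sf F}^k(G)$ is the set of spanning forests of $G$ with exactly $k$ trees, and $\tilde{\sf F}^k(\Phi|\aleph)$ the set of minimum-weight forests in ${\sf F}^k(\Phi|\aleph)$. For a spanning subgraph ${\textsc G}$ of $\Phi$ and ${\tt D}\subseteq{\tt N}$: ${\sf T}_{\tt D}({\textsc G})$ is the set of trees in ${\textsc G}$ with vertex set ${\tt D}$, $\nu_{\tt D}({\textsc G})$ their minimum weight; for distinct ${\tt X},{\tt Y}\in\aleph$, ${\sf T}_{\tt XY}({\textsc G})$ is the set of trees ${\textsc T}\subseteq{\textsc G}$ with ${\textsc T}|_{\tt X}\in{\sf T}_{\tt X}({\textsc G})$, $|{\tt V}{\textsc T}|=|{\tt X}|+1$, ${\tt V}{\textsc T}\cap{\tt Y}\ne\emptyset$, and $\nu_{\tt XY}({\textsc G})$ their minimum weight; the argument is omitted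 when ${\textsc G}=\Phi$. ${\textsc G}$ is tree-divisible by $\aleph$ if ${\textsc G}|_{\tt X}$ is connected for every ${\tt X}\in\aleph$. The splitting ${\textsc G}|\aleph={\textsc G}^\aleph$ of a tree-divisible ${\textsc G}$ is the undirected graph on vertex set $\aleph$ with an edge $({\tt X},{\tt Y})$, ${\tt X}\ne{\tt Y}$, iff ${\sf T}_{\tt XY}({\textsc G})\ne\emptyset$, of weight $\nu_{\tt XY}({\textsc G})-\nu_{\tt X}({\textsc G})$. ${\sf F}^{*k}$ is the set of forests in ${\sf F}^k(\Phi)$ tree-divisible by $\aleph$, and $\tilde{\sf F}^{*k}$ the set of those of minimum weight within ${\sf F}^{*k}$. A tree-divisible ${\textsc F}\in{\sf F}^k(\Phi)$ is a principal of a spanning forest ${\textsc F}'$ of $\Phi|\aleph$ if the edge set of ${\textsc F}'$ equals that of ${\textsc F}^\aleph$; a minimal principal of ${\textsc F}'$ is a principal of minimal weight among all principals of ${\textsc F}'$. *)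

theory Defs
  imports Complex_Main "HOL-Library.Disjoint_Sets"
begin

record 'a ugraph =
  verts :: "'a set"
  edges :: "'a set set"

definition ugraph :: "'a ugraph \<Rightarrow> bool" where
  "ugraph G \<longleftrightarrow> (\<forall>e\<in>edges G. e \<subseteq> verts G \<and> card e = 2)"

definition subgraph :: "'a ugraph \<Rightarrow> 'a ugraph \<Rightarrow> bool" where
  "subgraph H G \<longleftrightarrow> ugraph H \<and> verts H \<subseteq> verts G \<and> edges H \<subseteq> edges G"

definition induced :: "'a ugraph \<Rightarrow> 'a set \<Rightarrow> 'a ugraph" where
  "induced G D = \<lparr>verts = verts G \<inter> D, edges = {e \<in> edges G. e \<subseteq> D}\<rparr>"

definition adj :: "'a ugraph \<Rightarrow> 'a rel" where
  "adj G = {(u, v). {u, v} \<in> edges G}"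

definition connected_graph :: "'a ugraph \<Rightarrow> bool" where
  "connected_graph G \<longleftrightarrow> verts G \<noteq> {} \<and> (\<forall>u\<in>verts G. \<forall>v\<in>verts G. (u, v) \<in> (adj G)\<^sup>*)"

definition components :: "'a ugraph \<Rightarrow> 'a set set" where
  "components G = verts G // (adj G)\<^sup>*"

definition cycle :: "'a ugraph \<Rightarrow> 'a list \<Rightarrow> bool" where
  "cycle G vs \<longleftrightarrow> 3 \<le> length vs \<and> distinct vs
     \<and> successively (\<lambda>u v. {u, v} \<in> edges G) vs \<and> {last vs, hd vs} \<in> edges G"

definition forest :: "'a ugraph \<Rightarrow> bool" where
  "forest G \<longleftrightarrow> ugraph G \<and> (\<nexists>vs. cycle G vs)"

definition tree :: "'a ugraph \<Rightarrow> bool" where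
  "tree G \<longleftrightarrow> forest G \<and> connected_graph G"

text \<open>Edge weights are a function on edges, shared by all subgraphs of a given graph.\<close>

definition weight :: "('a set \<Rightarrow> real) \<Rightarrow> 'a ugraph \<Rightarrow> real" where
  "weight \<phi> G = (\<Sum>e\<in>edges G. \<phi> e)"

definition spanning_forests :: "nat \<Rightarrow> 'a ugraph \<Rightarrow> 'a ugraph set" where
  "spanning_forests k G =
     {F. subgraph F G \<and> verts F = verts G \<and> forest F \<and> card (components F) = k}"

definition min_weight :: "('a set \<Rightarrow> real) \<Rightarrow> 'a ugraph set \<Rightarrow> 'a ugraph set" where
  "min_weight \<phi> S = {F. is_arg_min (weight \<phi>) (\<lambda>F. F \<in> S) F}"

definition trees_on :: "'a ugraph \<Rightarrow> 'a set \<Rightarrow> 'a ugraph set" where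
  "trees_on G D = {T. subgraph T G \<and> tree T \<and> verts T = D}"

definition nu :: "('a set \<Rightarrow> real) \<Rightarrow> 'a ugraph \<Rightarrow> 'a set \<Rightarrow> real" where
  "nu \<phi> G D = Min (weight \<phi> ` trees_on G D)"

definition link_trees :: "'a ugraph \<Rightarrow> 'a set \<Rightarrow> 'a set \<Rightarrow> 'a ugraph set" where
  "link_trees G X Y = {T. subgraph T G \<and> tree T \<and> induced T X \<in> trees_on G X
     \<and> card (verts T) = card X + 1 \<and> verts T \<inter> Y \<noteq> {}}"

definition link_nu :: "('a set \<Rightarrow> real) \<Rightarrow> 'a ugraph \<Rightarrow> 'a set \<Rightarrow> 'a set \<Rightarrow> real" where
  "link_nu \<phi> G X Y = Min (weight \<phi> ` link_trees G X Y)"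

definition tree_divisible :: "'a set set \<Rightarrow> 'a ugraph \<Rightarrow> bool" where
  "tree_divisible P G \<longleftrightarrow> (\<forall>X\<in>P. connected_graph (induced G X))"

definition splitting :: "'a set set \<Rightarrow> 'a ugraph \<Rightarrow> 'a set ugraph" where
  "splitting P G = \<lparr>verts = P,
     edges = {{X, Y} | X Y. X \<in> P \<and> Y \<in> P \<and> X \<noteq> Y \<and> link_trees G X Y \<noteq> {}}\<rparr>"

text \<open>The defining formula is not visibly symmetric in the two ends of the edge;
  lemma \<open>split_weight_eq\<close> below shows that it is, so that the description is well defined.\<close>

definition split_weight ::
    "('a set \<Rightarrow> real) \<Rightarrow> 'a set set \<Rightarrow> 'a ugraph \<Rightarrow> 'a set set \<Rightarrow> real" where
  "split_weight \<phi> P G e =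
     (THE r. \<exists>X\<in>P. \<exists>Y\<in>P. X \<noteq> Y \<and> e = {X, Y} \<and> r = link_nu \<phi> G X Y - nu \<phi> G X)"

definition divisible_forests :: "nat \<Rightarrow> 'a set set \<Rightarrow> 'a ugraph \<Rightarrow> 'a ugraph set" where
  "divisible_forests k P G = {F \<in> spanning_forests k G. tree_divisible P F}"

definition principal :: "'a set set \<Rightarrow> 'a ugraph \<Rightarrow> 'a set ugraph \<Rightarrow> 'a ugraph \<Rightarrow> bool" where
  "principal P G F' F \<longleftrightarrow>
     (\<exists>k. F \<in> divisible_forests k P G) \<and> edges F' = edges (splitting P F)"

definition minimal_principal ::
    "('a set \<Rightarrow> real) \<Rightarrow> 'a set set \<Rightarrow> 'a ugraph \<Rightarrow> 'a set ugraph \<Rightarrow> 'a ugraph \<Rightarrow> bool" where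
  "minimal_principal \<phi> P G F' F \<longleftrightarrow> is_arg_min (weight \<phi>) (principal P G F') F"


section \<open>The weight of a splitting is well defined\<close>

lemma adj_sym: "(u, v) \<in> adj G \<Longrightarrow> (v, u) \<in> adj G"
  by (simp add: adj_def insert_commute)

lemma adj_rtrancl_sym: "(u, v) \<in> (adj G)\<^sup>* \<Longrightarrow> (v, u) \<in> (adj G)\<^sup>*"
  by (metis adj_sym symI sym_rtrancl symD)

lemma adj_rtrancl_path:
  assumes "(u, v) \<in> (adj G)\<^sup>*"
  shows "\<exists>p. p \<noteq> [] \<and> hd p = u \<and> last p = v \<and> distinct p \<and> set p \<subseteq> insert v (\<Union>(edges G))
           \<and> successively (\<lambda>u v. {u, v} \<in> edges G) p"
  using assms
proof (induction rule: converse_rtrancl_induct)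
  case base
  show ?case by (rule exI[of _ "[v]"]) auto
next
  case (step u w)
  then obtain p where p: "p \<noteq> []" "hd p = w" "last p = v" "distinct p"
      "set p \<subseteq> insert v (\<Union>(edges G))" "successively (\<lambda>u v. {u, v} \<in> edges G) p" by blast
  have e: "{u, w} \<in> edges G" using step by (simp add: adj_def)
  show ?case
  proof (cases "u \<in> set p")
    case True
    then obtain a b where ab: "p = a @ u # b" by (meson split_list)
    show ?thesis
      by (rule exI[of _ "u # b"]) (use p ab in \<open>auto simp: successively_append_iff\<close>)
  next
    case False
    show ?thesis
      by (rule exI[of _ "u # p"]) (use p e False in \<open>auto simp: successively_Cons\<close>)
  qed
qed

lemma path_adj_rtrancl:
  "successively (\<lambda>u v. {u, v} \<in> edges G) p \<Longrightarrow> p \<noteq> [] \<Longrightarrow> (hd p, last p) \<in> (adj G)\<^sup>*"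
proof (induction p)
  case (Cons a p)
  then show ?case
    by (cases p) (auto simp: successively_Cons adj_def intro: converse_rtrancl_into_rtrancl)
qed simp

lemma finite_ugraph_edges: "ugraph G \<Longrightarrow> finite (verts G) \<Longrightarrow> finite (edges G)"
  by (rule finite_subset[of _ "Pow (verts G)"]) (auto simp: ugraph_def)

lemma cycle_edge_redundant:
  assumes c: "cycle G vs" and ne: "verts H = verts G"
    and H: "edges H = edges G - {{last vs, hd vs}}"
    and conn: "connected_graph G"
  shows "connected_graph H"
proof -
  have len: "3 \<le> length vs" and d: "distinct vs"
    and s: "successively (\<lambda>u v. {u, v} \<in> edges G) vs"
    using c by (auto simp: cycle_def)
  have vne: "vs \<noteq> []" using len by auto
  have "successively (\<lambda>u v. {u, v} \<in> edges H) vs"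
    unfolding successively_conv_nth
  proof (intro allI impI)
    fix i assume i: "Suc i < length vs"
    have "{vs ! i, vs ! Suc i} \<noteq> {vs ! (length vs - 1), vs ! 0}"
    proof
      assume "{vs ! i, vs ! Suc i} = {vs ! (length vs - 1), vs ! 0}"
      then have "vs ! Suc i = vs ! (length vs - 1) \<and> vs ! i = vs ! 0 \<or>
                 vs ! Suc i = vs ! 0"
        by (auto simp: doubleton_eq_iff)
      then show False
      proof
        assume "vs ! Suc i = vs ! (length vs - 1) \<and> vs ! i = vs ! 0"
        then have "Suc i = length vs - 1" "i = 0"
          using i d vne by (simp_all add: nth_eq_iff_index_eq)
        then show False using len by simp
      next
        assume "vs ! Suc i = vs ! 0"
        then show False using i d vne by (simp add: nth_eq_iff_index_eq)
      qed
    qed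
    then show "{vs ! i, vs ! Suc i} \<in> edges H"
      using s i vne by (simp add: H successively_conv_nth last_conv_nth hd_conv_nth)
  qed
  then have hl: "(hd vs, last vs) \<in> (adj H)\<^sup>*" using path_adj_rtrancl vne by blast
  have "adj G \<subseteq> (adj H)\<^sup>*"
  proof
    fix q assume "q \<in> adj G"
    then obtain a b where q: "q = (a, b)" "{a, b} \<in> edges G" by (auto simp: adj_def)
    show "q \<in> (adj H)\<^sup>*"
    proof (cases "{a, b} = {last vs, hd vs}")
      case True
      then show ?thesis using hl adj_rtrancl_sym[OF hl] q by (auto simp: doubleton_eq_iff)
    next
      case False
      then show ?thesis using q H by (auto simp: adj_def)
    qed
  qed
  then have "(adj G)\<^sup>* \<subseteq> (adj H)\<^sup>*" by (metis rtrancl_idemp rtrancl_mono)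
  then show ?thesis using conn ne by (auto simp: connected_graph_def)
qed

lemma connected_graph_trees_on:
  assumes "ugraph G" "finite (verts G)" "connected_graph G"
  shows "trees_on G (verts G) \<noteq> {}"
proof -
  let ?P = "\<lambda>H. subgraph H G \<and> verts H = verts G \<and> connected_graph H"
  have "?P G" using assms by (auto simp: subgraph_def)
  then obtain T where T: "?P T" and least: "\<And>H. ?P H \<Longrightarrow> card (edges T) \<le> card (edges H)"
    using ex_has_least_nat[of ?P G "\<lambda>H. card (edges H)"] by blast
  have fin: "finite (edges T)" using T assms finite_ugraph_edges[of T] by (simp add: subgraph_def)
  have "\<not> cycle T vs" for vs
  proof
    assume c: "cycle T vs"
    let ?H = "\<lparr>verts = verts T, edges = edges T - {{last vs, hd vs}}\<rparr>"
    have "connected_graph ?H" by (rule cycle_edge_redundant[OF c]) (use T in auto)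
    then have "?P ?H" using T by (auto simp: subgraph_def ugraph_def)
    then have "card (edges T) \<le> card (edges T - {{last vs, hd vs}})" using least by force
    moreover have "{last vs, hd vs} \<in> edges T" using c by (simp add: cycle_def)
    ultimately show False using fin by (meson card_Diff1_less not_le)
  qed
  then have "T \<in> trees_on G (verts G)"
    using T by (auto simp: trees_on_def tree_def forest_def subgraph_def)
  then show ?thesis by auto
qed

lemma tree_divisible_trees_on:
  assumes "ugraph G" "finite (verts G)" "tree_divisible P G" "X \<in> P" "X \<subseteq> verts G"
  shows "trees_on G X \<noteq> {}"
proof -
  have eq: "verts (induced G X) = X" using assms by (auto simp: induced_def)
  have "trees_on (induced G X) X \<noteq> {}"
  proof -
    have "ugraph (induced G X)" using assms(1) by (auto simp: ugraph_def induced_def)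
    moreover have "finite X" using assms by (auto intro: finite_subset)
    ultimately show ?thesis
      using connected_graph_trees_on[of "induced G X"] assms by (simp add: eq tree_divisible_def)
  qed
  moreover have "trees_on (induced G X) X \<subseteq> trees_on G X"
    by (auto simp: trees_on_def subgraph_def induced_def)
  ultimately show ?thesis by auto
qed

lemma finite_trees:
  assumes "ugraph G" "finite (verts G)"
  shows "finite {T. subgraph T G}"
proof (rule finite_subset)
  show "{T. subgraph T G} \<subseteq> (\<lambda>(V, E). \<lparr>verts = V, edges = E\<rparr>) ` (Pow (verts G) \<times> Pow (edges G))"
  proof
    fix T :: "'a ugraph" assume "T \<in> {T. subgraph T G}"
    then show "T \<in> (\<lambda>(V, E). \<lparr>verts = V, edges = E\<rparr>) ` (Pow (verts G) \<times> Pow (edges G))"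
      by (intro image_eqI[of _ _ "(verts T, edges T)"]) (auto simp: subgraph_def)
  qed
  show "finite ((\<lambda>(V, E). \<lparr>verts = V, edges = E\<rparr>) ` (Pow (verts G) \<times> Pow (edges G)))"
    using assms finite_ugraph_edges by auto
qed

definition cross_edges :: "'a ugraph \<Rightarrow> 'a set \<Rightarrow> 'a set \<Rightarrow> 'a set set" where
  "cross_edges G X Y = {e \<in> edges G. \<exists>x\<in>X. \<exists>y\<in>Y. e = {x, y}}"

lemma cross_edges_sym: "cross_edges G X Y = cross_edges G Y X"
  unfolding cross_edges_def by (metis (lifting) insert_commute)

lemma link_tree_split:
  assumes G: "ugraph G" "finite (verts G)" and XY: "X \<inter> Y = {}" and T: "T \<in> link_trees G X Y"
  shows "\<exists>S\<in>trees_on G X. \<exists>e\<in>cross_edges G X Y. weight \<phi> T = weight \<phi> S + \<phi> e"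
proof -
  let ?S = "induced T X"
  have T': "subgraph T G" "tree T" "?S \<in> trees_on G X" "card (verts T) = card X + 1"
      "verts T \<inter> Y \<noteq> {}"
    using T by (auto simp: link_trees_def)
  have XT: "X \<subseteq> verts T" using T'(3) by (auto simp: trees_on_def induced_def)
  have finT: "finite (verts T)" using T'(1) G by (auto simp: subgraph_def intro: finite_subset)
  have ugT: "ugraph T" using T'(1) by (simp add: subgraph_def)
  have finE: "finite (edges T)" using finite_ugraph_edges ugT finT by blast
  obtain y where y: "y \<in> verts T" "y \<in> Y" using T'(5) by auto
  have yX: "y \<notin> X" using y XY by auto
  have V: "verts T = insert y X"
    using card_subset_eq[of "verts T" "insert y X"] finT XT y yX T'(4)
    by (simp add: finite_subset[OF XT finT])
  have conS: "connected_graph ?S" and Xne: "X \<noteq> {}"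
    using T'(3) by (auto simp: trees_on_def tree_def connected_graph_def)
  have vS: "verts ?S = X" using T'(3) by (auto simp: trees_on_def)
  obtain x0 where "x0 \<in> X" using Xne by auto
  then have "(y, x0) \<in> (adj T)\<^sup>*" "y \<noteq> x0"
    using T'(2) V yX by (auto simp: tree_def connected_graph_def)
  then obtain x where x: "{y, x} \<in> edges T" by (metis adj_def case_prodD converse_rtranclE mem_Collect_eq)
  have "card {y, x} = 2" "x \<in> insert y X" using ugT x V by (auto simp: ugraph_def)
  then have xX: "x \<in> X" by (auto simp: card_insert_if split: if_splits)
  have uniq: "z = x" if z: "z \<in> X" "{y, z} \<in> edges T" for z
  proof (rule ccontr)
    assume "z \<noteq> x"
    have "(z, x) \<in> (adj ?S)\<^sup>*" using conS z(1) xX vS by (auto simp: connected_graph_def)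
    then obtain p where p: "p \<noteq> []" "hd p = z" "last p = x" "distinct p"
        "set p \<subseteq> insert x (\<Union>(edges ?S))" "successively (\<lambda>u v. {u, v} \<in> edges ?S) p"
      using adj_rtrancl_path by metis
    have sub: "set p \<subseteq> X" using p(5) xX by (auto simp: induced_def)
    have "length p \<ge> 2" using p(1-3) \<open>z \<noteq> x\<close> by (cases p; cases "tl p") auto
    moreover have "successively (\<lambda>u v. {u, v} \<in> edges T) p"
      by (rule successively_mono[OF p(6)]) (auto simp: induced_def)
    ultimately have "cycle T (y # p)"
      using p sub yX z x by (auto simp: cycle_def successively_Cons insert_commute)
    then show False using T'(2) by (auto simp: tree_def forest_def)
  qed
  have E: "edges T = insert {x, y} (edges ?S)"
  proof
    show "edges T \<subseteq> insert {x, y} (edges ?S)"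
    proof
      fix e assume e: "e \<in> edges T"
      then have e2: "e \<subseteq> insert y X" "card e = 2" using ugT V by (auto simp: ugraph_def)
      show "e \<in> insert {x, y} (edges ?S)"
      proof (cases "y \<in> e")
        case True
        then obtain z where z: "e = {y, z}" "z \<noteq> y" using e2(2) by (auto simp: card_2_iff)
        then have "z \<in> X" using e2 by auto
        then show ?thesis using uniq e z by auto
      next
        case False
        then show ?thesis using e e2 by (auto simp: induced_def)
      qed
    qed
    show "insert {x, y} (edges ?S) \<subseteq> edges T" using x by (auto simp: induced_def insert_commute)
  qed
  have "{x, y} \<notin> edges ?S" using yX by (auto simp: induced_def)
  moreover have "finite (edges ?S)" using finE by (auto simp: induced_def)
  ultimately have "weight \<phi> T = weight \<phi> ?S + \<phi> {x, y}"
    by (simp add: weight_def E)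
  moreover have "{x, y} \<in> cross_edges G X Y"
    using T'(1) E xX y by (auto simp: cross_edges_def subgraph_def)
  ultimately show ?thesis using T'(3) by blast
qed

lemma link_tree_join:
  assumes G: "ugraph G" "finite (verts G)" and XY: "X \<inter> Y = {}"
    and S: "S \<in> trees_on G X" and e: "e \<in> cross_edges G X Y"
  shows "\<exists>T\<in>link_trees G X Y. weight \<phi> T = weight \<phi> S + \<phi> e"
proof -
  obtain x y where xy: "x \<in> X" "y \<in> Y" "e = {x, y}" "e \<in> edges G"
    using e by (auto simp: cross_edges_def)
  have yX: "y \<notin> X" using xy XY by auto
  have S': "subgraph S G" "forest S" "connected_graph S" "verts S = X" "ugraph S"
    using S by (auto simp: trees_on_def tree_def forest_def)
  have yS: "y \<notin> f" if "f \<in> edges S" for f using that S' yX by (auto simp: ugraph_def)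
  define T where "T = \<lparr>verts = insert y X, edges = insert e (edges S)\<rparr>"
  have T[simp]: "verts T = insert y X" "edges T = insert e (edges S)" by (simp_all add: T_def)
  have ugT: "ugraph T" using S' xy yX by (auto simp: ugraph_def card_2_iff)
  have sub: "subgraph T G"
    using ugT S' xy G(1) by (auto simp: subgraph_def ugraph_def)
  have nb: "u = x" if "{u, y} \<in> edges T \<or> {y, u} \<in> edges T" for u
    using that yS xy yX by (auto simp: doubleton_eq_iff)
  have "\<not> cycle T vs" for vs
  proof
    assume c: "cycle T vs"
    then have c': "3 \<le> length vs" "distinct vs" "successively (\<lambda>u v. {u, v} \<in> edges T) vs"
      "{last vs, hd vs} \<in> edges T" by (auto simp: cycle_def)
    show False
    proof (cases "y \<in> set vs")
      case True
      then obtain a b where ab: "vs = a @ y # b" by (meson split_list)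
      have b: "b \<noteq> [] \<Longrightarrow> hd b = x"
        using c'(3) nb by (auto simp: ab successively_append_iff successively_Cons simp del: T)
      have a: "a \<noteq> [] \<Longrightarrow> last a = x"
        using c'(3) nb by (auto simp: ab successively_append_iff successively_Cons simp del: T)
      show False
      proof (cases "a = []")
        case True
        then have "b \<noteq> []" "tl b \<noteq> []" using c'(1) ab by (cases b; cases "tl b"; simp)+
        moreover have "last b = x" using c'(4) nb ab True calculation by (auto simp del: T)
        moreover note b
        ultimately show False using c'(2) ab by (cases b) (auto simp: True)
      next
        case False
        show False
        proof (cases "b = []")
          case True
          have "hd a = x" using c'(4) nb ab True False by (auto simp del: T)
          moreover have "tl a \<noteq> []" using c'(1) ab True by (cases a) auto
          ultimately show False using a[OF False] False c'(2) ab by (cases a) auto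
        next
          case bne: False
          have "last a \<in> set a" "hd b \<in> set b" using False bne by auto
          then show False using a[OF False] b[OF bne] c'(2) ab by auto
        qed
      qed
    next
      case False
      have *: "{u, v} \<in> edges S" if "{u, v} \<in> edges T" "u \<in> set vs" "v \<in> set vs" for u v
        using that False xy by (auto simp: doubleton_eq_iff)
      have "vs \<noteq> []" using c' by auto
      then have "cycle S vs"
        using c' * by (auto simp: cycle_def simp del: T intro: successively_mono)
      then show False using S' by (auto simp: forest_def)
    qed
  qed
  then have "forest T" using ugT by (simp add: forest_def)
  moreover have "connected_graph T"
  proof -
    have "(adj S)\<^sup>* \<subseteq> (adj T)\<^sup>*" by (rule rtrancl_mono) (auto simp: adj_def)
    then have SX: "(u, v) \<in> (adj T)\<^sup>*" if "u \<in> X" "v \<in> X" for u v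
      using S' that by (auto simp: connected_graph_def)
    have "(x, y) \<in> adj T" using xy by (simp add: adj_def)
    then have xu: "(x, u) \<in> (adj T)\<^sup>*" if "u \<in> insert y X" for u
      using that SX xy by auto
    show ?thesis
      unfolding connected_graph_def T(1) by (meson xu adj_rtrancl_sym rtrancl_trans insert_not_empty)
  qed
  ultimately have "tree T" by (simp add: tree_def)
  moreover have "induced T X = S"
    using xy yX S' by (auto simp: induced_def ugraph_def intro!: ugraph.equality)
  moreover have "finite X" using S' G by (auto simp: subgraph_def intro: finite_subset)
  ultimately have "T \<in> link_trees G X Y"
    using sub S yX xy by (auto simp: link_trees_def)
  moreover have "weight \<phi> T = weight \<phi> S + \<phi> e"
  proof -
    have "finite (edges S)" using finite_ugraph_edges S' \<open>finite X\<close> by blast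
    moreover have "e \<notin> edges S" using yS xy by auto
    ultimately show ?thesis by (simp add: weight_def)
  qed
  ultimately show ?thesis by blast
qed

lemma link_trees_nonempty_iff:
  assumes "ugraph G" "finite (verts G)" "X \<inter> Y = {}" "trees_on G X \<noteq> {}"
  shows "link_trees G X Y \<noteq> {} \<longleftrightarrow> cross_edges G X Y \<noteq> {}"
  using link_tree_split[OF assms(1-3)] link_tree_join[OF assms(1-3)] assms(4) by fast

lemma link_nu_eq:
  assumes G: "ugraph G" "finite (verts G)" and XY: "X \<inter> Y = {}"
    and ne: "trees_on G X \<noteq> {}" "cross_edges G X Y \<noteq> {}"
  shows "link_nu \<phi> G X Y = nu \<phi> G X + Min (\<phi> ` cross_edges G X Y)"
proof -
  have f1: "finite (trees_on G X)" and f2: "finite (link_trees G X Y)"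
    using finite_trees[OF G] by (auto simp: trees_on_def link_trees_def)
  have f3: "finite (cross_edges G X Y)"
    using finite_ugraph_edges[OF G] by (auto simp: cross_edges_def)
  show ?thesis
    unfolding link_nu_def
  proof (rule Min_eqI)
    show "finite (weight \<phi> ` link_trees G X Y)" using f2 by simp
  next
    fix r assume "r \<in> weight \<phi> ` link_trees G X Y"
    then obtain S e where "S \<in> trees_on G X" "e \<in> cross_edges G X Y" "r = weight \<phi> S + \<phi> e"
      using link_tree_split[OF G XY] by blast
    then show "nu \<phi> G X + Min (\<phi> ` cross_edges G X Y) \<le> r"
      using f1 f3 by (auto simp: nu_def intro!: add_mono)
  next
    have "nu \<phi> G X \<in> weight \<phi> ` trees_on G X" "Min (\<phi> ` cross_edges G X Y) \<in> \<phi> ` cross_edges G X Y"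
      unfolding nu_def using f1 f3 ne by (auto intro!: Min_in)
    then show "nu \<phi> G X + Min (\<phi> ` cross_edges G X Y) \<in> weight \<phi> ` link_trees G X Y"
      using link_tree_join[OF G XY] by (smt (verit) image_iff)
  qed
qed

lemma split_weight_eq:
  assumes G: "ugraph G" "finite (verts G)" and P: "partition_on (verts G) P" "tree_divisible P G"
    and XY: "X \<in> P" "Y \<in> P" "X \<noteq> Y" "link_trees G X Y \<noteq> {}"
  shows "split_weight \<phi> P G {X, Y} = link_nu \<phi> G X Y - nu \<phi> G X"
proof -
  have dj: "X \<inter> Y = {}" "Y \<inter> X = {}"
    using P XY by (auto simp: partition_on_def disjoint_def)
  have ne: "trees_on G X \<noteq> {}" "trees_on G Y \<noteq> {}"
    using tree_divisible_trees_on[OF G P(2)] XY P(1) by (auto simp: partition_on_def)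
  have ce: "cross_edges G X Y \<noteq> {}" "cross_edges G Y X \<noteq> {}"
    using link_trees_nonempty_iff[OF G dj(1) ne(1)] XY cross_edges_sym[of G X Y] by auto
  have sym: "link_nu \<phi> G Y X - nu \<phi> G Y = link_nu \<phi> G X Y - nu \<phi> G X"
    using link_nu_eq[OF G dj(1) ne(1) ce(1)] link_nu_eq[OF G dj(2) ne(2) ce(2)]
      cross_edges_sym[of G X Y] by simp
  show ?thesis
    unfolding split_weight_def
    by (rule the_equality) (use XY sym in \<open>auto simp: doubleton_eq_iff\<close>)
qed

end

theory Submission
  imports Defs
begin

text \<open>
  For a graph that is tree-divisible by \<open>P\<close>, the blocks met by a component of the graph form a
  component of its splitting, so both have equally many components. A graph with \<open>n\<close> vertices and
  \<open>c\<close> components has at least \<open>n - c\<close> edges, with equality exactly for forests; counting edges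
  inside and between blocks therefore shows that a tree-divisible graph is a forest iff it induces
  trees on the blocks, its splitting is a forest, and no two of its edges join the same pair of
  blocks. Hence the weight of a tree-divisible forest \<open>F\<close> is at least the constant
  \<open>\<Sum>X\<in>P. nu \<phi> \<Phi> X\<close> plus the weight of its splitting, and every spanning forest of the splitting
  of \<open>\<Phi>\<close> has a principal attaining this bound: choose minimum trees in the blocks and minimum
  edges between them. So minimising over either kind of forest is the same problem.
\<close>

section \<open>Counting edges of forests\<close>

lemma components_eq_image: "components G = (\<lambda>x. (adj G)\<^sup>* `` {x}) ` verts G"
  by (auto simp: components_def quotient_def)

lemma equiv_adj_rtrancl: "equiv UNIV ((adj G)\<^sup>*)"
  by (auto simp: equiv_def refl_on_def sym_def trans_rtrancl adj_rtrancl_sym)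

lemma adj_class_eq_iff:
  "(adj G)\<^sup>* `` {x} = (adj G)\<^sup>* `` {y} \<longleftrightarrow> (x, y) \<in> (adj G)\<^sup>*"
  by (meson UNIV_I equiv_adj_rtrancl eq_equiv_class_iff)

lemma adj_rtrancl_verts:
  assumes "ugraph G" "(x, y) \<in> (adj G)\<^sup>*" "x \<in> verts G"
  shows "y \<in> verts G"
  using assms(2,3,1) by (induction rule: rtrancl_induct) (auto simp: adj_def ugraph_def)

lemma adj_insert_edge:
  assumes "edges G = insert {u, v} (edges H)"
  shows "adj G = adj H \<union> {(u, v), (v, u)}"
  using assms by (auto simp: adj_def doubleton_eq_iff)

lemma components_insert_redundant_edge:
  assumes G: "edges G = insert {u, v} (edges H)" "verts G = verts H"
    and uv: "(u, v) \<in> (adj H)\<^sup>*"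
  shows "components G = components H"
proof -
  have "adj H \<subseteq> adj G" "adj G \<subseteq> (adj H)\<^sup>*"
    using adj_insert_edge[OF G(1)] uv adj_rtrancl_sym[OF uv] by auto
  then have "(adj G)\<^sup>* = (adj H)\<^sup>*"
    by (rule rtrancl_subset)
  then show ?thesis using G(2) by (simp add: components_def)
qed

text \<open>The added edge glues the classes of \<open>u\<close> and \<open>v\<close> into one and
  leaves every other class alone, so exactly one component is lost.\<close>

lemma card_components_insert_bridge:
  assumes G: "edges G = insert {u, v} (edges H)" "verts G = verts H"
    and fin: "finite (verts H)" and uv: "u \<in> verts H" "v \<in> verts H" "(u, v) \<notin> (adj H)\<^sup>*"
  shows "card (components H) = Suc (card (components G))"
proof -
  let ?R = "(adj H)\<^sup>*"
  let ?U = "?R `` {u}" and ?V = "?R `` {v}"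
  \<comment> \<open>The explicit equivalence relation obtained from \<open>?R\<close> by merging the
    classes of \<open>u\<close> and \<open>v\<close>; it turns out to be the reachability of
    \<open>G\<close>.\<close>
  let ?Q = "?R \<union> (?U \<union> ?V) \<times> (?U \<union> ?V)"
  note sy = adj_rtrancl_sym[of _ _ H]
  have RG: "(adj G)\<^sup>* = ?Q"
  proof
    have mono: "?R \<subseteq> (adj G)\<^sup>*"
      using adj_insert_edge[OF G(1)] by (intro rtrancl_mono) auto
    have "(u, v) \<in> (adj G)\<^sup>*" using adj_insert_edge[OF G(1)] by auto
    then have "(u, x) \<in> (adj G)\<^sup>*" if "x \<in> ?U \<union> ?V" for x
      using that mono by (auto intro: rtrancl_trans)
    then have "(x, y) \<in> (adj G)\<^sup>*" if "x \<in> ?U \<union> ?V" "y \<in> ?U \<union> ?V" for x y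
      using that by (meson adj_rtrancl_sym rtrancl_trans)
    then show "?Q \<subseteq> (adj G)\<^sup>*" using mono by auto
    show "(adj G)\<^sup>* \<subseteq> ?Q"
    proof
      fix p assume "p \<in> (adj G)\<^sup>*"
      then obtain x y where p: "p = (x, y)" and "(x, y) \<in> (adj G)\<^sup>*" by (cases p) auto
      from this(2) have "(x, y) \<in> ?Q"
      proof (induction rule: rtrancl_induct)
        case base
        show ?case by simp
      next
        case (step y z)
        from step(2) consider "(y, z) \<in> adj H" | "y = u" "z = v" | "y = v" "z = u"
          using adj_insert_edge[OF G(1)] by auto
        then show ?case
        proof cases
          case 1
          then show ?thesis using step(3) by (auto intro: rtrancl_into_rtrancl)
        qed (use step(3) in \<open>auto dest: sy\<close>)
      qed
      then show "p \<in> ?Q" using p by simp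
    qed
  qed
  have cls: "(adj G)\<^sup>* `` {x} = (if x \<in> ?U \<union> ?V then ?U \<union> ?V else ?R `` {x})" for x
  proof (cases "x \<in> ?U \<union> ?V")
    case True
    then have "?R `` {x} \<subseteq> ?U \<union> ?V" by (auto intro: rtrancl_trans)
    then show ?thesis using True by (auto simp: RG)
  qed (auto simp: RG)
  have mem: "x \<in> ?U \<union> ?V \<longleftrightarrow> ?R `` {x} \<in> {?U, ?V}" for x
    using adj_class_eq_iff[of H x u] adj_class_eq_iff[of H x v] by (auto dest: sy)
  have eq: "components G = insert (?U \<union> ?V) (components H - {?U, ?V})"
  proof
    show "components G \<subseteq> insert (?U \<union> ?V) (components H - {?U, ?V})"
      unfolding components_eq_image using cls mem G(2) by auto
    have "?U \<union> ?V \<in> components G"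
      unfolding components_eq_image using cls[of u] uv G(2) by (intro image_eqI[of _ _ u]) auto
    moreover have "components H - {?U, ?V} \<subseteq> components G"
    proof
      fix K assume "K \<in> components H - {?U, ?V}"
      then obtain x where x: "x \<in> verts H" "K = ?R `` {x}" "x \<notin> ?U \<union> ?V"
        unfolding components_eq_image using mem by blast
      then show "K \<in> components G"
        unfolding components_eq_image using cls[of x] G(2) by (intro image_eqI[of _ _ x]) auto
    qed
    ultimately show "insert (?U \<union> ?V) (components H - {?U, ?V}) \<subseteq> components G" by simp
  qed
  \<comment> \<open>A component containing both \<open>u\<close> and \<open>v\<close> would connect
    them in \<open>H\<close>. Hence the merged class is new and the \<open>insert\<close> in
    \<open>eq\<close> adds one to the cardinality.\<close>
  have "?U \<union> ?V \<notin> components H"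
  proof
    assume "?U \<union> ?V \<in> components H"
    then obtain x where "?R `` {x} = ?U \<union> ?V" unfolding components_eq_image by auto
    then have "(x, u) \<in> ?R" "(x, v) \<in> ?R" by blast+
    then show False using uv(3) sy rtrancl_trans by meson
  qed
  moreover have fc: "finite (components H)" using fin by (simp add: components_eq_image)
  moreover have "card (components H - {?U, ?V}) = card (components H) - 2"
    and two: "2 \<le> card (components H)"
  proof -
    have "?U \<noteq> ?V" using uv(3) adj_class_eq_iff[of H u v] by simp
    then have c2: "card {?U, ?V} = 2" by simp
    have sub: "{?U, ?V} \<subseteq> components H" unfolding components_eq_image using uv by auto
    show "card (components H - {?U, ?V}) = card (components H) - 2"
      using card_Diff_subset[OF _ sub] c2 by simp
    show "2 \<le> card (components H)" using card_mono[OF fc sub] c2 by simp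
  qed
  ultimately show ?thesis by (simp add: eq)
qed

section \<open>Vertices against components plus edges; forests as the case of equality\<close>

lemma ugraph_delete_edge:
  assumes "ugraph G" "e \<in> edges G"
  obtains u v where "e = {u, v}" "u \<in> verts G" "v \<in> verts G" "u \<noteq> v"
    "ugraph \<lparr>verts = verts G, edges = edges G - {e}\<rparr>"
  using assms by (auto simp: ugraph_def card_2_iff)

text \<open>Induction on the number of edges: deleting an edge raises the number of components by at
  most one, and without edges every vertex is its own component.\<close>

lemma card_verts_le:
  assumes "ugraph G" "finite (verts G)"
  shows "card (verts G) \<le> card (components G) + card (edges G)"
  using assms
proof (induction "card (edges G)" arbitrary: G)
  case 0
  then have "edges G = {}" using finite_ugraph_edges by fastforce
  then have "(adj G)\<^sup>* = Id" by (auto simp: adj_def)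
  then have "components G = (\<lambda>x. {x}) ` verts G" by (simp add: components_eq_image)
  then show ?case by (simp add: card_image)
next
  case (Suc n)
  then obtain e where e: "e \<in> edges G" by fastforce
  let ?H = "\<lparr>verts = verts G, edges = edges G - {e}\<rparr>"
  obtain u v where uv: "e = {u, v}" "u \<in> verts G" "v \<in> verts G" and H: "ugraph ?H"
    using ugraph_delete_edge[OF Suc.prems(1) e] by metis
  have fe: "finite (edges G)" using Suc.prems finite_ugraph_edges by blast
  have cH: "card (edges ?H) = n" using Suc(2) e fe by simp
  have IH: "card (verts G) \<le> card (components ?H) + n"
    using Suc(1)[of ?H] cH H Suc.prems by simp
  have ins: "edges G = insert {u, v} (edges ?H)" "verts G = verts ?H" using e uv by auto
  show ?case
  proof (cases "(u, v) \<in> (adj ?H)\<^sup>*")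
    case True
    then show ?thesis using components_insert_redundant_edge[OF ins True] IH Suc(2) by simp
  next
    case False
    then show ?thesis
      using card_components_insert_bridge[OF ins] IH Suc(2) Suc.prems(2) uv by simp
  qed
qed

text \<open>A path from \<open>u\<close> to \<open>v\<close> that avoids the edge would close up
  with it to a cycle.\<close>

lemma forest_edge_bridge:
  assumes "forest G" "{u, v} \<in> edges G" "edges H = edges G - {{u, v}}"
  shows "(u, v) \<notin> (adj H)\<^sup>*"
proof
  assume "(u, v) \<in> (adj H)\<^sup>*"
  then obtain p where p: "p \<noteq> []" "hd p = u" "last p = v" "distinct p"
      "successively (\<lambda>u v. {u, v} \<in> edges H) p"
    using adj_rtrancl_path by metis
  have "u \<noteq> v" using assms(1,2) by (auto simp: forest_def ugraph_def)
  \<comment> \<open>As \<open>u\<close> and \<open>v\<close> differ, a shorter path could only be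
    \<open>[u, v]\<close>, which uses the deleted edge.\<close>
  have "3 \<le> length p"
  proof (rule ccontr)
    assume "\<not> 3 \<le> length p"
    then have "p = [u, v]" using p(1-3) \<open>u \<noteq> v\<close>
      by (cases p; cases "tl p"; cases "tl (tl p)") auto
    then show False using p(5) assms(3) by simp
  qed
  moreover have "successively (\<lambda>u v. {u, v} \<in> edges G) p"
    by (rule successively_mono[OF p(5)]) (use assms(3) in auto)
  ultimately have "cycle G p" using p assms(2) by (simp add: cycle_def insert_commute)
  then show False using assms(1) by (auto simp: forest_def)
qed

lemma forest_subset_edges:
  assumes "forest G" "ugraph H" "edges H \<subseteq> edges G"
  shows "forest H"
proof -
  have "cycle G vs" if "cycle H vs" for vs
    using that assms(3) by (auto simp: cycle_def intro: successively_mono)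
  then show ?thesis using assms by (auto simp: forest_def)
qed

text \<open>The induction of \<open>card_verts_le\<close> again; in a forest every deleted edge is a
  bridge, so each deletion gains exactly one component.\<close>

lemma forest_card_verts:
  assumes "forest G" "finite (verts G)"
  shows "card (verts G) = card (components G) + card (edges G)"
  using assms
proof (induction "card (edges G)" arbitrary: G)
  case 0
  then have "edges G = {}" using finite_ugraph_edges by (fastforce simp: forest_def)
  then have "(adj G)\<^sup>* = Id" by (auto simp: adj_def)
  then have "components G = (\<lambda>x. {x}) ` verts G" by (simp add: components_eq_image)
  then show ?case using \<open>edges G = {}\<close> by (simp add: card_image)
next
  case (Suc n)
  have ug: "ugraph G" using Suc.prems by (simp add: forest_def)
  obtain e where e: "e \<in> edges G" using Suc(2) by fastforce
  let ?H = "\<lparr>verts = verts G, edges = edges G - {e}\<rparr>"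
  obtain u v where uv: "e = {u, v}" "u \<in> verts G" "v \<in> verts G" and H: "ugraph ?H"
    using ugraph_delete_edge[OF ug e] by metis
  have fe: "finite (edges G)" using ug Suc.prems finite_ugraph_edges by blast
  have cH: "card (edges ?H) = n" using Suc(2) e fe by simp
  have "forest ?H" by (rule forest_subset_edges[OF Suc.prems(1) H]) auto
  then have IH: "card (verts G) = card (components ?H) + n"
    using Suc(1)[of ?H] cH Suc.prems by simp
  have ins: "edges G = insert {u, v} (edges ?H)" "verts G = verts ?H" using e uv by auto
  have "(u, v) \<notin> (adj ?H)\<^sup>*"
    by (rule forest_edge_bridge[OF Suc.prems(1)]) (use e uv in auto)
  then show ?case
    using card_components_insert_bridge[OF ins] IH Suc(2) Suc.prems(2) uv by simp
qed

text \<open>Deleting an edge of a cycle keeps the components but lowers the edge count, so the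
  remaining graph would violate \<open>card_verts_le\<close>.\<close>

lemma forestI_card:
  assumes G: "ugraph G" "finite (verts G)"
    and card: "card (verts G) = card (components G) + card (edges G)"
  shows "forest G"
proof -
  have "\<not> cycle G vs" for vs
  proof
    assume c: "cycle G vs"
    define e where "e = {last vs, hd vs}"
    have e: "e \<in> edges G" using c by (simp add: cycle_def e_def)
    let ?H = "\<lparr>verts = verts G, edges = edges G - {e}\<rparr>"
    have H: "ugraph ?H" using ugraph_delete_edge[OF G(1) e] by metis
    \<comment> \<open>\<open>connected_graph\<close> only inspects the listed vertices, so restricting them to the ends
      of \<open>e\<close> makes \<open>cycle_edge_redundant\<close> applicable to a disconnected graph.\<close>
    let ?G2 = "\<lparr>verts = {last vs, hd vs}, edges = edges G\<rparr>"
    let ?H2 = "\<lparr>verts = {last vs, hd vs}, edges = edges G - {e}\<rparr>"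
    have "connected_graph ?G2"
      using e by (auto simp: connected_graph_def adj_def e_def insert_commute)
    moreover have "cycle ?G2 vs" using c by (simp add: cycle_def)
    ultimately have "connected_graph ?H2"
      using cycle_edge_redundant[of ?G2 vs ?H2] by (simp add: e_def)
    then have "(last vs, hd vs) \<in> (adj ?H)\<^sup>*"
      by (simp add: connected_graph_def adj_def)
    then have "components G = components ?H"
      by (intro components_insert_redundant_edge) (use e in \<open>auto simp: e_def\<close>)
    moreover have "card (verts ?H) \<le> card (components ?H) + card (edges ?H)"
      using card_verts_le[OF H] G by simp
    moreover have "card (edges ?H) < card (edges G)"
      using e finite_ugraph_edges[OF G] by (simp add: card_Diff1_less del: card_Diff_insert)
    ultimately show False using card by simp
  qed
  then show ?thesis using G by (simp add: forest_def)
qed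

lemma connected_graph_card_components:
  assumes "ugraph G" "connected_graph G"
  shows "card (components G) = 1"
proof -
  obtain x where x: "x \<in> verts G" using assms by (auto simp: connected_graph_def)
  have "components G = {(adj G)\<^sup>* `` {x}}"
    unfolding components_eq_image using assms x adj_class_eq_iff[of G]
    by (force simp: connected_graph_def)
  then show ?thesis by simp
qed

lemma tree_card_edges:
  assumes "tree T" "finite (verts T)"
  shows "card (verts T) = Suc (card (edges T))"
  using assms forest_card_verts[of T] connected_graph_card_components[of T]
  by (simp add: tree_def forest_def)


section \<open>Edges inside and between blocks\<close>

text \<open>The quotient map on edges: an edge joining two blocks of a partition goes to the pair of
  these blocks, an edge inside one block to a singleton.\<close>

definition blocks :: "'a set set \<Rightarrow> 'a set \<Rightarrow> 'a set set" where
  "blocks P e = {X \<in> P. X \<inter> e \<noteq> {}}"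

text \<open>Phrased by non-containment so that it is the complement of the edge sets of all
  \<open>induced G X\<close>.\<close>

definition crossing :: "'a set set \<Rightarrow> 'a ugraph \<Rightarrow> 'a set set" where
  "crossing P G = {e \<in> edges G. \<forall>X\<in>P. \<not> e \<subseteq> X}"

lemma partition_on_block_unique:
  assumes "partition_on V P" "X \<in> P" "Y \<in> P" "x \<in> X" "x \<in> Y"
  shows "X = Y"
  using partition_onD2[OF assms(1)] assms(2-5) unfolding disjoint_def by blast

lemma blocks_pair:
  assumes P: "partition_on V P" and XY: "X \<in> P" "Y \<in> P" "x \<in> X" "y \<in> Y"
  shows "blocks P {x, y} = {X, Y}"
proof
  show "blocks P {x, y} \<subseteq> {X, Y}"
    using partition_on_block_unique[OF P _ XY(1) _ XY(3)]
      partition_on_block_unique[OF P _ XY(2) _ XY(4)] unfolding blocks_def by blast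
  show "{X, Y} \<subseteq> blocks P {x, y}" using XY unfolding blocks_def by blast
qed

lemma crossing_pair:
  assumes P: "partition_on V P" and XY: "X \<in> P" "Y \<in> P" "x \<in> X" "y \<in> Y"
  shows "{x, y} \<in> crossing P G \<longleftrightarrow> {x, y} \<in> edges G \<and> X \<noteq> Y"
proof -
  have "(\<exists>Z\<in>P. {x, y} \<subseteq> Z) \<longleftrightarrow> X = Y"
    using partition_on_block_unique[OF P _ XY(1) _ XY(3)]
      partition_on_block_unique[OF P _ XY(2) _ XY(4)] XY by blast
  then show ?thesis unfolding crossing_def by blast
qed

lemma ugraph_edge_blocks:
  assumes "ugraph G" "partition_on (verts G) P" "e \<in> edges G"
  obtains x y X Y where "e = {x, y}" "x \<noteq> y" "X \<in> P" "Y \<in> P" "x \<in> X" "y \<in> Y"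
proof -
  obtain x y where xy: "e = {x, y}" "x \<noteq> y" "x \<in> verts G" "y \<in> verts G"
    using ugraph_delete_edge[OF assms(1,3)] by metis
  then obtain X Y where "X \<in> P" "Y \<in> P" "x \<in> X" "y \<in> Y"
    using partition_onD1[OF assms(2)] by blast
  then show thesis using that xy by blast
qed

text \<open>Translates the edges between two given blocks into a fibre of \<open>blocks\<close>, so
  that the splitting can be treated as an image under one map.\<close>

lemma cross_edges_eq_crossing:
  assumes G: "ugraph G" "partition_on (verts G) P" and XY: "X \<in> P" "Y \<in> P" "X \<noteq> Y"
  shows "cross_edges G X Y = {e \<in> crossing P G. blocks P e = {X, Y}}"
proof
  show "cross_edges G X Y \<subseteq> {e \<in> crossing P G. blocks P e = {X, Y}}"
    using crossing_pair[OF G(2)] blocks_pair[OF G(2)] XY by (auto simp: cross_edges_def)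
  show "{e \<in> crossing P G. blocks P e = {X, Y}} \<subseteq> cross_edges G X Y"
  proof
    fix e assume e: "e \<in> {e \<in> crossing P G. blocks P e = {X, Y}}"
    then have eG: "e \<in> edges G" by (auto simp: crossing_def)
    then obtain x y A B where xy: "e = {x, y}" "A \<in> P" "B \<in> P" "x \<in> A" "y \<in> B"
      using ugraph_edge_blocks[OF G] by metis
    then have "{A, B} = {X, Y}" using e blocks_pair[OF G(2)] by auto
    then show "e \<in> cross_edges G X Y"
      using xy eG by (auto simp: cross_edges_def doubleton_eq_iff insert_commute)
  qed
qed

text \<open>Every block has a spanning tree, so a link tree exists as soon as one edge joins the two
  blocks. The splitting is thus the simple quotient graph.\<close>

lemma splitting_edges:
  assumes G: "ugraph G" "finite (verts G)" and P: "partition_on (verts G) P" "tree_divisible P G"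
  shows "edges (splitting P G) = blocks P ` crossing P G"
proof -
  have link: "link_trees G X Y \<noteq> {} \<longleftrightarrow> cross_edges G X Y \<noteq> {}"
    if "X \<in> P" "Y \<in> P" "X \<noteq> Y" for X Y
  proof (rule link_trees_nonempty_iff[OF G])
    show "X \<inter> Y = {}" using P that by (auto simp: partition_on_def disjoint_def)
    show "trees_on G X \<noteq> {}"
      using tree_divisible_trees_on[OF G P(2) that(1)] P(1) that by (auto simp: partition_on_def)
  qed
  show ?thesis
  proof
    show "edges (splitting P G) \<subseteq> blocks P ` crossing P G"
    proof
      fix d assume "d \<in> edges (splitting P G)"
      then obtain X Y where XY: "d = {X, Y}" "X \<in> P" "Y \<in> P" "X \<noteq> Y" "link_trees G X Y \<noteq> {}"
        by (auto simp: splitting_def)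
      then show "d \<in> blocks P ` crossing P G"
        using link[OF XY(2-4)] cross_edges_eq_crossing[OF G(1) P(1) XY(2-4)] by auto
    qed
    show "blocks P ` crossing P G \<subseteq> edges (splitting P G)"
    proof
      fix d assume "d \<in> blocks P ` crossing P G"
      then obtain e where e: "e \<in> crossing P G" "d = blocks P e" by auto
      then have "e \<in> edges G" by (simp add: crossing_def)
      then obtain x y X Y where xy: "e = {x, y}" "X \<in> P" "Y \<in> P" "x \<in> X" "y \<in> Y"
        using ugraph_edge_blocks[OF G(1) P(1)] by metis
      have ne: "X \<noteq> Y" using e xy crossing_pair[OF P(1)] by auto
      have d: "d = {X, Y}" using e xy blocks_pair[OF P(1)] by simp
      then have "e \<in> cross_edges G X Y"
        using cross_edges_eq_crossing[OF G(1) P(1) xy(2,3) ne] e by auto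
      then show "d \<in> edges (splitting P G)"
        using link[OF xy(2,3) ne] xy d ne by (auto simp: splitting_def)
    qed
  qed
qed

text \<open>A lightest link tree is a lightest tree on \<open>X\<close> plus a lightest edge to
  \<open>Y\<close>; subtracting \<open>nu\<close> leaves the edge.\<close>

lemma split_weight_eq_Min:
  assumes G: "ugraph G" "finite (verts G)" and P: "partition_on (verts G) P" "tree_divisible P G"
    and d: "d \<in> edges (splitting P G)"
  shows "split_weight \<phi> P G d = Min (\<phi> ` {e \<in> crossing P G. blocks P e = d})"
proof -
  obtain X Y where XY: "d = {X, Y}" "X \<in> P" "Y \<in> P" "X \<noteq> Y" "link_trees G X Y \<noteq> {}"
    using d by (auto simp: splitting_def)
  have dj: "X \<inter> Y = {}" using P XY by (auto simp: partition_on_def disjoint_def)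
  have ne: "trees_on G X \<noteq> {}"
    using tree_divisible_trees_on[OF G P(2) XY(2)] P(1) XY by (auto simp: partition_on_def)
  have "cross_edges G X Y \<noteq> {}" using link_trees_nonempty_iff[OF G dj ne] XY by simp
  then show ?thesis
    using split_weight_eq[OF G P XY(2-5)] link_nu_eq[OF G dj ne]
      cross_edges_eq_crossing[OF G(1) P(1) XY(2-4)] XY(1) by simp
qed

text \<open>Edges are non-empty and blocks are disjoint, so no edge is counted in two
  blocks.\<close>

lemma weight_partition:
  assumes G: "ugraph G" "finite (verts G)" and P: "partition_on (verts G) P"
  shows "weight \<phi> G = (\<Sum>X\<in>P. weight \<phi> (induced G X)) + sum \<phi> (crossing P G)"
proof -
  have fP: "finite P" using finite_elements[OF G(2) P] .
  have fE: "finite (edges G)" using finite_ugraph_edges[OF G] .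
  have E: "edges G = (\<Union>X\<in>P. {e \<in> edges G. e \<subseteq> X}) \<union> crossing P G"
    by (auto simp: crossing_def)
  have "sum \<phi> (edges G) = sum \<phi> (\<Union>X\<in>P. {e \<in> edges G. e \<subseteq> X}) + sum \<phi> (crossing P G)"
    by (subst E, rule sum.union_disjoint)
      (use fE fP in \<open>auto simp: crossing_def\<close>)
  also have "sum \<phi> (\<Union>X\<in>P. {e \<in> edges G. e \<subseteq> X}) = (\<Sum>X\<in>P. sum \<phi> {e \<in> edges G. e \<subseteq> X})"
  proof (rule sum.UNION_disjoint)
    show "\<forall>X\<in>P. \<forall>Y\<in>P. X \<noteq> Y \<longrightarrow> {e \<in> edges G. e \<subseteq> X} \<inter> {e \<in> edges G. e \<subseteq> Y} = {}"
    proof (intro ballI impI)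
      fix X Y assume XY: "X \<in> P" "Y \<in> P" "X \<noteq> Y"
      then have "X \<inter> Y = {}" using P by (auto simp: partition_on_def disjoint_def)
      moreover have "e \<noteq> {}" if "e \<in> edges G" for e using that G(1) by (auto simp: ugraph_def)
      ultimately show "{e \<in> edges G. e \<subseteq> X} \<inter> {e \<in> edges G. e \<subseteq> Y} = {}" by blast
    qed
  qed (use fP fE in auto)
  finally show ?thesis by (simp add: weight_def induced_def)
qed

section \<open>Edge count of a graph with a tree on each block\<close>

lemma induced_tree:
  assumes "forest F" "connected_graph (induced F X)" "X \<subseteq> verts F"
  shows "tree (induced F X)" "verts (induced F X) = X"
proof -
  have "ugraph (induced F X)" using assms by (auto simp: ugraph_def induced_def forest_def)
  then have "forest (induced F X)"
    by (rule forest_subset_edges[OF assms(1)]) (auto simp: induced_def)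
  then show "tree (induced F X)" using assms by (simp add: tree_def)
  show "verts (induced F X) = X" using assms by (auto simp: induced_def)
qed

text \<open>Each block \<open>X\<close> contributes \<open>card X - 1\<close> edges, and the block
  sizes add up to the number of vertices.\<close>

lemma card_edges_partition:
  assumes G: "ugraph G" "finite (verts G)" and P: "partition_on (verts G) P"
    and T: "\<And>X. X \<in> P \<Longrightarrow> tree (induced G X)"
  shows "card (edges G) + card P = card (verts G) + card (crossing P G)"
proof -
  have sub: "X \<subseteq> verts G" if "X \<in> P" for X using P that by (auto simp: partition_on_def)
  \<comment> \<open>Unit weights turn \<open>weight_partition\<close> into a count; working in the
    reals keeps the subtractions exact.\<close>
  have "real (card (edges G)) = (\<Sum>X\<in>P. real (card (edges (induced G X)))) + card (crossing P G)"
    using weight_partition[OF G P, of "\<lambda>_. 1"] by (simp add: weight_def)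
  also have "(\<Sum>X\<in>P. real (card (edges (induced G X)))) = (\<Sum>X\<in>P. real (card X) - 1)"
  proof (rule sum.cong[OF refl])
    fix X assume X: "X \<in> P"
    have "verts (induced G X) = X" using sub[OF X] by (auto simp: induced_def)
    then show "real (card (edges (induced G X))) = real (card X) - 1"
      using tree_card_edges[OF T[OF X]] finite_subset[OF sub[OF X] G(2)] by simp
  qed
  also have "\<dots> = real (\<Sum>X\<in>P. card X) - card P" by (simp add: sum_subtractf)
  also have "(\<Sum>X\<in>P. card X) = card (verts G)"
    using product_partition[OF P] finite_subset[OF sub G(2)] by simp
  finally show ?thesis by linarith
qed


section \<open>Splitting preserves the number of components\<close>

lemma ugraph_splitting: "ugraph (splitting P G)"
  by (auto simp: ugraph_def splitting_def card_2_iff)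

text \<open>Taking unions maps the components of the splitting bijectively to those of
  \<open>G\<close>: blocks are connected, so walks lift from the splitting to \<open>G\<close>, and
  walks in \<open>G\<close> project to the splitting.\<close>

lemma card_components_splitting:
  assumes G: "ugraph G" "finite (verts G)" and P: "partition_on (verts G) P" "tree_divisible P G"
  shows "card (components (splitting P G)) = card (components G)"
proof -
  let ?S = "splitting P G"
  have vS: "verts ?S = P" by (simp add: splitting_def)
  have within: "(x, y) \<in> (adj G)\<^sup>*" if "X \<in> P" "x \<in> X" "y \<in> X" for X x y
  proof -
    have "x \<in> verts (induced G X)" "y \<in> verts (induced G X)"
      using that P(1) by (auto simp: induced_def partition_on_def)
    then have "(x, y) \<in> (adj (induced G X))\<^sup>*"
      using P(2) that(1) by (auto simp: tree_divisible_def connected_graph_def)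
    moreover have "adj (induced G X) \<subseteq> adj G" by (auto simp: adj_def induced_def)
    ultimately show ?thesis using rtrancl_mono by blast
  qed
  have ne: "\<exists>x. x \<in> X" if "X \<in> P" for X using that P(1) by (metis all_not_in_conv partition_onD3)
  have down: "(x, y) \<in> (adj G)\<^sup>*"
    if "(X, Y) \<in> (adj ?S)\<^sup>*" "X \<in> P" "x \<in> X" "y \<in> Y" for X Y x y
    using that
  \<comment> \<open>The endpoint \<open>y\<close> must vary: the edge chosen between
    \<open>Y\<close> and \<open>Z\<close> starts at some \<open>a\<close> in \<open>Y\<close> that
    cannot be prescribed.\<close>
  proof (induction arbitrary: y rule: rtrancl_induct)
    case base
    then show ?case using within by blast
  next
    case (step Y Z)
    have "{Y, Z} \<in> edges ?S" using step(2) by (simp add: adj_def)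
    then obtain e where e: "e \<in> crossing P G" "blocks P e = {Y, Z}"
      using splitting_edges[OF G P] by auto
    have YZ: "Y \<in> P" "Z \<in> P" "Y \<noteq> Z"
      using \<open>{Y, Z} \<in> edges ?S\<close> by (auto simp: splitting_def doubleton_eq_iff)
    then have "e \<in> cross_edges G Y Z" using cross_edges_eq_crossing[OF G(1) P(1) YZ] e by simp
    then obtain a b where ab: "a \<in> Y" "b \<in> Z" "{a, b} \<in> edges G"
      by (auto simp: cross_edges_def)
    have "(x, a) \<in> (adj G)\<^sup>*" using step ab by blast
    moreover have "(a, b) \<in> adj G" using ab by (simp add: adj_def)
    moreover have "(b, y) \<in> (adj G)\<^sup>*" using within[OF YZ(2) ab(2)] step by blast
    ultimately show ?case by (meson rtrancl.rtrancl_into_rtrancl rtrancl_trans)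
  qed
  have up: "(X, Y) \<in> (adj ?S)\<^sup>*"
    if "(x, y) \<in> (adj G)\<^sup>*" "X \<in> P" "Y \<in> P" "x \<in> X" "y \<in> Y" for X Y x y
    using that
  proof (induction arbitrary: Y rule: rtrancl_induct)
    case base
    then have "X = Y" using P(1) by (auto simp: partition_on_def disjoint_def)
    then show ?case by simp
  next
    case (step y z)
    have e: "{y, z} \<in> edges G" using step(2) by (simp add: adj_def)
    then have "y \<in> verts G" using G(1) by (auto simp: ugraph_def)
    then obtain Z where Z: "Z \<in> P" "y \<in> Z" using P(1) by (auto simp: partition_on_def)
    have XZ: "(X, Z) \<in> (adj ?S)\<^sup>*" using step Z by blast
    show ?case
    \<comment> \<open>An edge inside a block projects to no move at all, any other edge to an edge
      of the splitting.\<close>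
    proof (cases "Z = Y")
      case False
      then have "{y, z} \<in> crossing P G" "blocks P {y, z} = {Z, Y}"
        using crossing_pair[OF P(1) Z(1) step(5) Z(2) step(7)]
          blocks_pair[OF P(1) Z(1) step(5) Z(2) step(7)] e by auto
      then have "{Z, Y} \<in> edges ?S" unfolding splitting_edges[OF G P] by (metis imageI)
      then have "(Z, Y) \<in> adj ?S" by (simp add: adj_def)
      then show ?thesis using XZ by simp
    qed (use XZ in simp)
  qed
  have cls: "(adj G)\<^sup>* `` {x} = \<Union>((adj ?S)\<^sup>* `` {X})" if X: "X \<in> P" "x \<in> X" for X x
  proof
    have "x \<in> verts G" using X P(1) by (auto simp: partition_on_def)
    then show "(adj G)\<^sup>* `` {x} \<subseteq> \<Union>((adj ?S)\<^sup>* `` {X})"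
      using adj_rtrancl_verts[OF G(1)] up[OF _ X(1) _ X(2)] partition_onD1[OF P(1)] by blast
    show "\<Union>((adj ?S)\<^sup>* `` {X}) \<subseteq> (adj G)\<^sup>* `` {x}" using down X by blast
  qed
  have "components G = \<Union> ` components ?S"
  proof
    show "components G \<subseteq> \<Union> ` components ?S"
    proof
      fix K assume "K \<in> components G"
      then obtain x where x: "x \<in> verts G" "K = (adj G)\<^sup>* `` {x}"
        by (auto simp: components_eq_image)
      then obtain X where "X \<in> P" "x \<in> X" using P(1) by (auto simp: partition_on_def)
      then show "K \<in> \<Union> ` components ?S" using x cls vS by (auto simp: components_eq_image)
    qed
    show "\<Union> ` components ?S \<subseteq> components G"
    proof
      fix K assume "K \<in> \<Union> ` components ?S"
      then obtain X where X: "X \<in> P" "K = \<Union>((adj ?S)\<^sup>* `` {X})"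
        by (auto simp: components_eq_image vS)
      then obtain x where x: "x \<in> X" using ne by blast
      then have "x \<in> verts G" using X P(1) by (auto simp: partition_on_def)
      then show "K \<in> components G" using cls[OF X(1) x] X by (auto simp: components_eq_image)
    qed
  qed
  moreover have "inj_on \<Union> (components ?S)"
  proof (rule inj_onI)
    fix K L assume K: "K \<in> components ?S" and L: "L \<in> components ?S" and eq: "\<Union>K = \<Union>L"
    obtain X where X: "X \<in> P" "K = (adj ?S)\<^sup>* `` {X}" using K by (auto simp: components_eq_image vS)
    obtain Y where Y: "Y \<in> P" "L = (adj ?S)\<^sup>* `` {Y}" using L by (auto simp: components_eq_image vS)
    obtain x where x: "x \<in> X" using ne X by blast
    obtain y where y: "y \<in> Y" using ne Y by blast
    have "(adj G)\<^sup>* `` {x} = (adj G)\<^sup>* `` {y}" using cls[OF X(1) x] cls[OF Y(1) y] X Y eq by simp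
    then have "(X, Y) \<in> (adj ?S)\<^sup>*" using adj_class_eq_iff[of G] up X Y x y by blast
    then show "K = L" using adj_class_eq_iff[of ?S] X Y by simp
  qed
  ultimately show ?thesis by (simp add: card_image)
qed


section \<open>Weights of forests and of their splittings\<close>

text \<open>The forest count for \<open>F\<close> and the block trees give \<open>card P\<close> as
  components of the splitting plus crossing edges. \<open>card_verts_le\<close> bounds it by
  components plus edges of the splitting, which are images of crossing edges. Hence
  \<open>blocks\<close> identifies no two crossing edges, and the equality case makes the splitting
  a forest.\<close>

lemma splitting_divisible_forest:
  assumes F: "forest F" "finite (verts F)" and P: "partition_on (verts F) P" "tree_divisible P F"
  shows "forest (splitting P F)" "inj_on (blocks P) (crossing P F)"
proof -
  let ?S = "splitting P F"
  have ug: "ugraph F" using F by (simp add: forest_def)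
  have vS: "verts ?S = P" by (simp add: splitting_def)
  have fP: "finite P" using finite_elements[OF F(2) P(1)] .
  have fC: "finite (crossing P F)" using finite_ugraph_edges[OF ug F(2)] by (simp add: crossing_def)
  have "tree (induced F X)" if "X \<in> P" for X
    using induced_tree(1)[OF F(1)] P that by (auto simp: tree_divisible_def partition_on_def)
  then have "card (edges F) + card P = card (verts F) + card (crossing P F)"
    using card_edges_partition[OF ug F(2) P(1)] by blast
  then have C: "card P = card (components ?S) + card (crossing P F)"
    using forest_card_verts[OF F] card_components_splitting[OF ug F(2) P] by simp
  have le: "card P \<le> card (components ?S) + card (edges ?S)"
    using card_verts_le[OF ugraph_splitting, of P F] vS fP by simp
  have E: "edges ?S = blocks P ` crossing P F" using splitting_edges[OF ug F(2) P] .
  have eq: "card (blocks P ` crossing P F) = card (crossing P F)"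
    using card_image_le[OF fC, of "blocks P"] C le E by simp
  then show "inj_on (blocks P) (crossing P F)" using fC by (simp add: eq_card_imp_inj_on)
  show "forest ?S"
    by (rule forestI_card[OF ugraph_splitting]) (use vS fP C E eq in auto)
qed

text \<open>The tree that \<open>F\<close> induces on a block weighs at least the minimum there, and
  each crossing edge weighs at least the minimum of its fibre.\<close>

lemma divisible_forest_lower_bound:
  assumes G: "ugraph G" "finite (verts G)" and P: "partition_on (verts G) P" "tree_divisible P G"
    and F: "F \<in> divisible_forests k P G"
  shows "splitting P F \<in> spanning_forests k (splitting P G)"
    and "(\<Sum>X\<in>P. nu \<phi> G X) + weight (split_weight \<phi> P G) (splitting P F) \<le> weight \<phi> F"
proof -
  have F': "subgraph F G" "verts F = verts G" "forest F" "card (components F) = k"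
    "tree_divisible P F" "ugraph F"
    using F by (auto simp: divisible_forests_def spanning_forests_def forest_def)
  have finF: "finite (verts F)" and PF: "partition_on (verts F) P" using F' G P by auto
  note split = splitting_divisible_forest[OF F'(3) finF PF F'(5)]
  have sub: "crossing P F \<subseteq> crossing P G" using F'(1) by (auto simp: crossing_def subgraph_def)
  have E: "edges (splitting P F) = blocks P ` crossing P F"
    "edges (splitting P G) = blocks P ` crossing P G"
    using splitting_edges[OF F'(6) finF PF F'(5)] splitting_edges[OF G P] .
  show "splitting P F \<in> spanning_forests k (splitting P G)"
    using split(1) ugraph_splitting[of P F] E sub F'(4)
      card_components_splitting[OF F'(6) finF PF F'(5)]
    by (auto simp: spanning_forests_def subgraph_def splitting_def)
  have fC: "finite (crossing P G)" using finite_ugraph_edges[OF G] by (simp add: crossing_def)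
  have "nu \<phi> G X \<le> weight \<phi> (induced F X)" if X: "X \<in> P" for X
  proof -
    have "tree (induced F X)" "verts (induced F X) = X"
      using induced_tree[OF F'(3), of X] F'(5) X PF
      by (auto simp: tree_divisible_def partition_on_def)
    then have "induced F X \<in> trees_on G X"
      using F'(1) by (auto simp: trees_on_def subgraph_def induced_def tree_def forest_def)
    moreover have "finite (trees_on G X)"
      using finite_trees[OF G] by (rule rev_finite_subset) (auto simp: trees_on_def)
    ultimately show ?thesis by (simp add: nu_def)
  qed
  then have "(\<Sum>X\<in>P. nu \<phi> G X) \<le> (\<Sum>X\<in>P. weight \<phi> (induced F X))" by (rule sum_mono)
  moreover have "weight (split_weight \<phi> P G) (splitting P F) \<le> sum \<phi> (crossing P F)"
  proof -
    \<comment> \<open>Injectivity of \<open>blocks\<close> is what allows this reindexing: each edge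
      of the splitting comes from a single edge of \<open>F\<close>.\<close>
    have "weight (split_weight \<phi> P G) (splitting P F)
        = (\<Sum>e\<in>crossing P F. split_weight \<phi> P G (blocks P e))"
      unfolding weight_def E(1) by (simp add: sum.reindex[OF split(2)])
    also have "\<dots> \<le> sum \<phi> (crossing P F)"
    proof (rule sum_mono)
      fix e assume e: "e \<in> crossing P F"
      then have "split_weight \<phi> P G (blocks P e)
          = Min (\<phi> ` {f \<in> crossing P G. blocks P f = blocks P e})"
        using split_weight_eq_Min[OF G P] E sub by blast
      also have "\<dots> \<le> \<phi> e" using fC e sub by (intro Min_le) auto
      finally show "split_weight \<phi> P G (blocks P e) \<le> \<phi> e" .
    qed
    finally show ?thesis .
  qed
  ultimately show
    "(\<Sum>X\<in>P. nu \<phi> G X) + weight (split_weight \<phi> P G) (splitting P F) \<le> weight \<phi> F"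
    using weight_partition[OF F'(6) finF PF, of \<phi>] by simp
qed

text \<open>Witness: a minimum tree \<open>T X\<close> on every block and, over every edge
  \<open>d\<close> of \<open>F'\<close>, one lightest crossing edge \<open>c d\<close>. This attains
  the lower bound with equality.\<close>

lemma obtain_optimal_principal:
  assumes G: "ugraph G" "finite (verts G)" and P: "partition_on (verts G) P" "tree_divisible P G"
    and F': "F' \<in> spanning_forests k (splitting P G)"
  obtains F where "F \<in> divisible_forests k P G" "edges F' = edges (splitting P F)"
    "weight \<phi> F = (\<Sum>X\<in>P. nu \<phi> G X) + weight (split_weight \<phi> P G) F'"
proof -
  have F'': "edges F' \<subseteq> edges (splitting P G)" "verts F' = P" "forest F'" "card (components F') = k"
    using F' by (auto simp: spanning_forests_def subgraph_def splitting_def)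
  have fP: "finite P" using finite_elements[OF G(2) P(1)] .
  have fE: "finite (edges G)" using finite_ugraph_edges[OF G] .
  have fC: "finite (crossing P G)" using fE by (simp add: crossing_def)
  have sub: "X \<subseteq> verts G" if "X \<in> P" for X using P(1) that by (auto simp: partition_on_def)
  have "\<exists>T. T \<in> trees_on G X \<and> weight \<phi> T = nu \<phi> G X" if X: "X \<in> P" for X
  proof -
    have "finite (trees_on G X)"
      using finite_trees[OF G] by (rule rev_finite_subset) (auto simp: trees_on_def)
    then have "nu \<phi> G X \<in> weight \<phi> ` trees_on G X"
      unfolding nu_def using tree_divisible_trees_on[OF G P(2) X sub[OF X]] by (intro Min_in) auto
    then show ?thesis by auto
  qed
  then obtain T where T: "\<And>X. X \<in> P \<Longrightarrow> T X \<in> trees_on G X"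
    "\<And>X. X \<in> P \<Longrightarrow> weight \<phi> (T X) = nu \<phi> G X" by metis
  have "\<exists>e. e \<in> crossing P G \<and> blocks P e = d \<and> \<phi> e = split_weight \<phi> P G d"
    if d: "d \<in> edges F'" for d
  proof -
    have dG: "d \<in> edges (splitting P G)" using d F'' by auto
    let ?A = "{e \<in> crossing P G. blocks P e = d}"
    have "?A \<noteq> {}" using splitting_edges[OF G P] dG by auto
    then have "Min (\<phi> ` ?A) \<in> \<phi> ` ?A" using fC by (intro Min_in) auto
    then show ?thesis using split_weight_eq_Min[OF G P dG, of \<phi>] by auto
  qed
  then obtain c where c: "\<And>d. d \<in> edges F' \<Longrightarrow> c d \<in> crossing P G"
    "\<And>d. d \<in> edges F' \<Longrightarrow> blocks P (c d) = d"
    "\<And>d. d \<in> edges F' \<Longrightarrow> \<phi> (c d) = split_weight \<phi> P G d" by metis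
  have T': "edges (T X) \<subseteq> edges G" "\<And>e. e \<in> edges (T X) \<Longrightarrow> e \<subseteq> X \<and> e \<noteq> {}" "tree (T X)"
    "verts (T X) = X" if "X \<in> P" for X
    using T(1)[OF that] by (fastforce simp: trees_on_def subgraph_def ugraph_def)+
  define F where "F = \<lparr>verts = verts G, edges = (\<Union>X\<in>P. edges (T X)) \<union> c ` edges F'\<rparr>"
  have vF: "verts F = verts G" and eF: "edges F = (\<Union>X\<in>P. edges (T X)) \<union> c ` edges F'"
    by (simp_all add: F_def)
  have EF: "edges F \<subseteq> edges G" using T'(1) c(1) by (auto simp: eF crossing_def)
  then have ug: "ugraph F" using G(1) vF by (auto simp: ugraph_def)
  have finF: "finite (verts F)" and PF: "partition_on (verts F) P" using vF G P by auto
  \<comment> \<open>The chosen edges \<open>c d\<close> lie in no block, and a non-empty edge of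
    another tree lies in a disjoint block.\<close>
  have ind: "induced F X = T X" if X: "X \<in> P" for X
  proof (rule ugraph.equality)
    show "verts (induced F X) = verts (T X)" using sub[OF X] T'(4)[OF X] vF by (auto simp: induced_def)
    have "e \<in> edges (T X)" if e: "e \<in> edges F" "e \<subseteq> X" for e
    proof -
      have "e \<notin> c ` edges F'" using c(1) X e(2) by (auto simp: crossing_def)
      then obtain Y where Y: "Y \<in> P" "e \<in> edges (T Y)" using e(1) by (auto simp: eF)
      then have "X \<inter> Y \<noteq> {}" using T'(2)[OF Y] e(2) by auto
      then have "X = Y" using X Y P(1) by (auto simp: partition_on_def disjoint_def)
      then show ?thesis using Y by simp
    qed
    then show "edges (induced F X) = edges (T X)"
      using T'(2)[OF X] X by (auto simp: induced_def eF)
  qed simp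
  have cr: "crossing P F = c ` edges F'"
  proof
    show "crossing P F \<subseteq> c ` edges F'" using T'(2) unfolding crossing_def eF by blast
    show "c ` edges F' \<subseteq> crossing P F" using c(1) unfolding crossing_def eF by blast
  qed
  \<comment> \<open>\<open>blocks P\<close> is a left inverse of \<open>c\<close>.\<close>
  have inj: "inj_on c (edges F')" using c(2) by (metis inj_on_inverseI)
  have td: "tree_divisible P F"
    using ind T'(3) by (auto simp: tree_divisible_def tree_def)
  have ES: "edges F' = edges (splitting P F)"
    using splitting_edges[OF ug finF PF td] c(2) by (simp add: cr image_image)
  have "components F' = components (splitting P F)"
    using ES F''(2) by (simp add: components_def adj_def splitting_def)
  then have k: "card (components F) = k"
    using card_components_splitting[OF ug finF PF td] F''(4) by simp
  \<comment> \<open>Acyclicity by counting: eliminating \<open>card P\<close> from the two equations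
    leaves \<open>card (verts F) = k + card (edges F)\<close>, the criterion of
    \<open>forestI_card\<close>.\<close>
  have "card (edges F) + card P = card (verts F) + card (edges F')"
    using card_edges_partition[OF ug finF PF] ind T'(3) cr card_image[OF inj] by simp
  moreover have "card P = k + card (edges F')"
    using forest_card_verts[OF F''(3)] F''(2,4) fP by simp
  ultimately have "forest F" using forestI_card[OF ug finF] k by simp
  then have "F \<in> divisible_forests k P G"
    using ug EF vF k td by (simp add: divisible_forests_def spanning_forests_def subgraph_def)
  moreover have "weight \<phi> F = (\<Sum>X\<in>P. nu \<phi> G X) + weight (split_weight \<phi> P G) F'"
    using weight_partition[OF ug finF PF, of \<phi>] ind T(2) c(3)
    by (simp add: cr sum.reindex[OF inj] weight_def[of "split_weight \<phi> P G"])
  ultimately show thesis using that ES by blast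
qed

section \<open>Equivalence of the two minimisation problems\<close>

theorem theorem3:
  fixes \<Phi> :: "'a ugraph" and \<phi> :: "'a set \<Rightarrow> real" and P :: "'a set set"
    and F' :: "'a set ugraph" and F :: "'a ugraph" and k :: nat
  assumes "ugraph \<Phi>" and "finite (verts \<Phi>)"
    and "partition_on (verts \<Phi>) P" and "tree_divisible P \<Phi>"
    and "F' \<in> spanning_forests k (splitting P \<Phi>)"
    and "minimal_principal \<phi> P \<Phi> F' F"
  shows "F \<in> min_weight \<phi> (divisible_forests k P \<Phi>) \<longleftrightarrow>
         F' \<in> min_weight (split_weight \<phi> P \<Phi>) (spanning_forests k (splitting P \<Phi>))"
proof -
  note G = assms(1-4)
  let ?w = "weight (split_weight \<phi> P \<Phi>)"
  let ?C = "\<Sum>X\<in>P. nu \<phi> \<Phi> X"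
  have "principal P \<Phi> F' F" and least: "\<And>H. principal P \<Phi> F' H \<Longrightarrow> weight \<phi> F \<le> weight \<phi> H"
    using assms(6) by (auto simp: minimal_principal_def is_arg_min_def not_less)
  \<comment> \<open>A principal may a priori have any number of trees; that the number is
    \<open>k\<close> follows because \<open>F'\<close> and the splitting of \<open>F\<close> have
    the same components.\<close>
  then obtain k' where k': "F \<in> divisible_forests k' P \<Phi>" and E: "edges F' = edges (splitting P F)"
    by (auto simp: principal_def)
  have vF': "verts F' = P" using assms(5) by (simp add: spanning_forests_def splitting_def)
  then have eq: "components F' = components (splitting P F)" "?w F' = ?w (splitting P F)"
    using E by (simp_all add: components_def adj_def splitting_def weight_def)
  have "k' = k"
    using divisible_forest_lower_bound(1)[OF G k'] eq(1) assms(5) by (simp add: spanning_forests_def)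
  then have Fk: "F \<in> divisible_forests k P \<Phi>" using k' by simp
  obtain H where H: "H \<in> divisible_forests k P \<Phi>" "edges F' = edges (splitting P H)"
    "weight \<phi> H = ?C + ?w F'"
    using obtain_optimal_principal[OF G assms(5)] by blast
  have "weight \<phi> F \<le> ?C + ?w F'" using least[of H] H by (auto simp: principal_def)
  moreover have "?C + ?w F' \<le> weight \<phi> F"
    using divisible_forest_lower_bound(2)[OF G Fk, of \<phi>] eq(2) by simp
  \<comment> \<open>A minimal principal weighs no more than the optimal principal \<open>H\<close>,
    so it meets the lower bound exactly.\<close>
  ultimately have W: "weight \<phi> F = ?C + ?w F'" by simp
  show ?thesis
  proof
    assume min: "F \<in> min_weight \<phi> (divisible_forests k P \<Phi>)"
    \<comment> \<open>A competitor \<open>K'\<close> of \<open>F'\<close> is lifted to an optimal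
      principal \<open>K\<close>, a competitor of \<open>F\<close>; the constant \<open>?C\<close>
      cancels.\<close>
    have "?w F' \<le> ?w K'" if K': "K' \<in> spanning_forests k (splitting P \<Phi>)" for K'
    proof -
      obtain K where "K \<in> divisible_forests k P \<Phi>" "weight \<phi> K = ?C + ?w K'"
        using obtain_optimal_principal[OF G K'] by blast
      then show ?thesis using min W by (force simp: min_weight_def is_arg_min_def)
    qed
    then show "F' \<in> min_weight (split_weight \<phi> P \<Phi>) (spanning_forests k (splitting P \<Phi>))"
      using assms(5) by (force simp: min_weight_def is_arg_min_def)
  next
    assume min: "F' \<in> min_weight (split_weight \<phi> P \<Phi>) (spanning_forests k (splitting P \<Phi>))"
    \<comment> \<open>Conversely, a competitor \<open>K\<close> of \<open>F\<close> is projected to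
      its splitting, a competitor of \<open>F'\<close>.\<close>
    have "weight \<phi> F \<le> weight \<phi> K" if "K \<in> divisible_forests k P \<Phi>" for K
    proof -
      have "?w F' \<le> ?w (splitting P K)"
        using min divisible_forest_lower_bound(1)[OF G that]
        by (auto simp: min_weight_def is_arg_min_def not_less)
      then show ?thesis using divisible_forest_lower_bound(2)[OF G that, of \<phi>] W by simp
    qed
    then show "F \<in> min_weight \<phi> (divisible_forests k P \<Phi>)"
      using Fk by (force simp: min_weight_def is_arg_min_def)
  qed
qed

end
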